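(* Assume that there exist $r>0$ and finite constants $M_1,M_2$ such that $h(\bm x;\bm\gamma)$ is twice continuously differentiable with respect to $\bm\gamma\in\mathcal B(\bm\gamma_0,r)$ for all $\bm x\in\mathcal X$, and $$\sup_{\bm x\in\mathcal X}\|\nabla h(\bm x;\bm\gamma_0)\|\le M_1<\infty,\qquad \sup_{\bm x\in\mathcal X}\ \sup_{\bm\gamma\in\mathcal B(\bm\gamma_0,r)}\|h''(\bm x;\bm\gamma)\|_2\le M_2<\infty .$$ Assume also that $\bm\lambda$ belongs to a bounded set $\bm\Lambda\subset\mathbb{R}^s$: $\sup_{\bm\lambda\in\bm\Lambda}\|\bm\lambda\|\le L<\infty$. Then, with $\bm\gamma_1=\bm\gamma_0+\bm\lambda/\sqrt n$, for all $\bm\lambda\in\bm\Lambda$, $$\sup_{\xi\in\Xi}\left|\,n\big(I_{12}(\xi;\bm\gamma_1)-1\big)-\zeta(\xi;\bm\lambda;\bm\gamma_0)\right|=O(n^{-1/2})\qquad(n\to\infty).$$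
   Context: Setting. $\mathcal X\subseteq\mathbb{R}^p$ is compact; a design $\xi$ is a discrete (finitely supported) probability measure on $\mathcal X$ with support points $\bm x_1,\dots,\bm x_k$ and weights $\xi(\bm x_i)$; $\Xi$ is the set of all designs. $\mu(\bm x;\bm\beta)$, $\bm\beta\in\mathbb{R}^m$, is a real-valued mean function; $h:\mathbb{R}^p\times\mathbb{R}^s\to\mathbb{R}_+$ is a continuous positive function, and $\bm\gamma_0\in\mathbb{R}^s$ is such that $h(\bm x;\bm\gamma_0)=1$ for all $\bm x$. $\nabla h$ and $h''$ are the gradient and Hessian of $h$ with respect to $\bm\gamma$; $\mathcal B(\bm\gamma_0,r)$ is the ball of radius $r$ centred at $\bm\gamma_0$; $\|\cdot\|$ is the Euclidean norm and $\|\cdot\|_2$ the spectral norm of a matrix. KL-criterion: for fixed known $\bm\beta_1\in\mathbb{R}^m$, $\sigma_1^2>0$ and $\bm\gamma_1\in\mathbb{R}^s$, $$I_{12}(\xi;\bm\gamma_1)=\min_{\bm\beta\in\mathbb{R}^m,\ \sigma^2>0}\ \sum_{i=1}^k\left(\frac{\sigma_1^2h(\bm x_i;\bm\gamma_1)+[\mu(\bm x_i;\bm\beta_1)-\mu(\bm x_i;\bm\beta)]^2}{\sigma^2}-\log\frac{\sigma_1^2h(\bm x_i;\bm\gamma_1)}{\sigma^2}\right)\xi(\bm x_i).$$ Noncentrality parameter: $$\zeta(\xi;\bm\lambda;\bm\gamma_0)=\frac12\bm\lambda^T\left(\sum_{i=1}^k\nabla h(\bm x_i;\bm\gamma_0)\nabla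 h(\bm x_i;\bm\gamma_0)^T\xi(\bm x_i)-\sum_{i=1}^k\nabla h(\bm x_i;\bm\gamma_0)\xi(\bm x_i)\sum_{i=1}^k\nabla h(\bm x_i;\bm\gamma_0)^T\xi(\bm x_i)\right)\bm\lambda .$$ *)

theory Defs
  imports "HOL-Probability.Probability" "HOL-Library.Landau_Symbols"
begin

definition designs :: "(real ^ 'p) set \<Rightarrow> (real ^ 'p) pmf set" where
  "designs X = {\<xi>. finite (set_pmf \<xi>) \<and> set_pmf \<xi> \<subseteq> X}"

definition gradient :: "(real ^ 's \<Rightarrow> real) \<Rightarrow> real ^ 's \<Rightarrow> real ^ 's" where
  "gradient f \<gamma> = (\<chi> i. frechet_derivative f (at \<gamma>) (axis i 1))"

definition hessian :: "(real ^ 's \<Rightarrow> real) \<Rightarrow> real ^ 's \<Rightarrow> real ^ 's ^ 's" where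
  "hessian f \<gamma> = jacobian (gradient f) (at \<gamma>)"

text \<open>Intended for open \<^term>\<open>S\<close>: derivatives are taken in the full space, not relative
  to \<^term>\<open>S\<close>.\<close>
definition twice_continuously_differentiable_on ::
    "(real ^ 's \<Rightarrow> real) \<Rightarrow> (real ^ 's) set \<Rightarrow> bool" where
  "twice_continuously_differentiable_on f S \<longleftrightarrow>
     (\<forall>\<gamma>\<in>S. f differentiable (at \<gamma>)) \<and>
     (\<forall>\<gamma>\<in>S. gradient f differentiable (at \<gamma>)) \<and>
     continuous_on S (hessian f)"

definition spectral_norm :: "real ^ 'n ^ 'm \<Rightarrow> real" where
  "spectral_norm A = onorm (\<lambda>v. A *v v)"

text \<open>The parameters \<^term>\<open>v1\<close> and \<^term>\<open>v\<close> are the variances \<open>\<sigma>\<^sub>1\<^sup>2\<close> and \<open>\<sigma>\<^sup>2\<close>.\<close>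
definition KL_objective ::
    "(real ^ 'p \<Rightarrow> real ^ 'm \<Rightarrow> real) \<Rightarrow> (real ^ 'p \<Rightarrow> real ^ 's \<Rightarrow> real) \<Rightarrow> real ^ 'm \<Rightarrow> real \<Rightarrow>
     (real ^ 'p) pmf \<Rightarrow> real ^ 's \<Rightarrow> real ^ 'm \<Rightarrow> real \<Rightarrow> real" where
  "KL_objective \<mu> h \<beta>1 v1 \<xi> \<gamma>1 \<beta> v =
     (\<Sum>x\<in>set_pmf \<xi>.
        ((v1 * h x \<gamma>1 + (\<mu> x \<beta>1 - \<mu> x \<beta>)\<^sup>2) / v - ln (v1 * h x \<gamma>1 / v)) * pmf \<xi> x)"

text \<open>For a real-valued function, \<open>LEAST\<close> over its set of values is its minimum
  whenever the minimum is attained (as it is here, at \<open>\<beta> = \<beta>1\<close> and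
  \<open>v = v1 * (\<Sum>x\<in>set_pmf \<xi>. h x \<gamma>1 * pmf \<xi> x)\<close>, if \<open>v1\<close> and \<open>h\<close> are positive).\<close>
definition KL_criterion ::
    "(real ^ 'p \<Rightarrow> real ^ 'm \<Rightarrow> real) \<Rightarrow> (real ^ 'p \<Rightarrow> real ^ 's \<Rightarrow> real) \<Rightarrow> real ^ 'm \<Rightarrow> real \<Rightarrow>
     (real ^ 'p) pmf \<Rightarrow> real ^ 's \<Rightarrow> real" where
  "KL_criterion \<mu> h \<beta>1 v1 \<xi> \<gamma>1 =
     (LEAST c. \<exists>\<beta> v. v > 0 \<and> c = KL_objective \<mu> h \<beta>1 v1 \<xi> \<gamma>1 \<beta> v)"

text \<open>The matrix \<open>v v\<^sup>T\<close>; the index type \<open>1\<close> in between makes the product a genuine outer product.\<close>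
definition outer_square :: "real ^ 's \<Rightarrow> real ^ 's ^ 's" where
  "outer_square v = (columnvector v :: real ^ 1 ^ 's) ** (rowvector v :: real ^ 's ^ 1)"

definition noncentrality ::
    "(real ^ 'p \<Rightarrow> real ^ 's \<Rightarrow> real) \<Rightarrow> (real ^ 'p) pmf \<Rightarrow> real ^ 's \<Rightarrow> real ^ 's \<Rightarrow> real" where
  "noncentrality h \<xi> l \<gamma>0 =
     1 / 2 * (l \<bullet>
       (((\<Sum>x\<in>set_pmf \<xi>. pmf \<xi> x *\<^sub>R outer_square (gradient (h x) \<gamma>0))
         - outer_square (\<Sum>x\<in>set_pmf \<xi>. pmf \<xi> x *\<^sub>R gradient (h x) \<gamma>0)) *v l))"

definition approximation_error ::
    "(real ^ 'p \<Rightarrow> real ^ 'm \<Rightarrow> real) \<Rightarrow> (real ^ 'p \<Rightarrow> real ^ 's \<Rightarrow> real) \<Rightarrow> real ^ 'm \<Rightarrow> real \<Rightarrow>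
     real ^ 's \<Rightarrow> real ^ 's \<Rightarrow> nat \<Rightarrow> (real ^ 'p) pmf \<Rightarrow> real" where
  "approximation_error \<mu> h \<beta>1 v1 \<gamma>0 l n \<xi> =
     \<bar>real n * (KL_criterion \<mu> h \<beta>1 v1 \<xi> (\<gamma>0 + (1 / sqrt (real n)) *\<^sub>R l) - 1)
       - noncentrality h \<xi> l \<gamma>0\<bar>"

end

theory Submission
  imports Defs
begin

text \<open>Dropping the mean discrepancy and optimising over the variance gives
  \<open>I = 1 + ln (E h) - E (ln h)\<close>, the expectations being taken over the design. Near \<open>\<gamma>0\<close> one has
  \<open>h = 1 + d\<close> with \<open>d\<close> equal to \<open>\<nabla>h \<bullet> \<lambda> / sqrt n\<close> up to \<open>O(1/n)\<close>, and the expansion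
  \<open>ln (1 + d) = d - d\<^sup>2/2 + O(d\<^sup>3)\<close> turns \<open>I - 1\<close> into half the variance of \<open>d\<close> up to
  \<open>O(n powr (- 3/2))\<close>, uniformly in the design.\<close>

section \<open>Second-order expansion of the logarithm under weighted averages\<close>

text \<open>Mean value inequality on the interval from -|x| to |x|: the difference to be bounded
  vanishes at 0, and its derivative \<open>y\<^sup>2 / (1 + y)\<close> is at most
  \<open>2 * x\<^sup>2\<close> there because \<open>1 + y\<close> is at least 1/2.\<close>

lemma abs_ln_one_plus_second_order:
  fixes x :: real
  assumes "\<bar>x\<bar> \<le> 1 / 2"
  shows "\<bar>ln (1 + x) - x + x\<^sup>2 / 2\<bar> \<le> 2 * \<bar>x\<bar> ^ 3"
proof -
  define f where "f = (\<lambda>y::real. ln (1 + y) - y + y\<^sup>2 / 2)"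
  let ?S = "{- \<bar>x\<bar>..\<bar>x\<bar>}"
  have "norm (f x - f 0) \<le> (2 * x\<^sup>2) * norm (x - 0)"
  proof (rule field_differentiable_bound[where S = ?S and f' = "\<lambda>y. y\<^sup>2 / (1 + y)"])
    fix y assume y: "y \<in> ?S"
    then have pos: "1 / 2 \<le> 1 + y" and abs: "\<bar>y\<bar> \<le> \<bar>x\<bar>" using assms by auto
    have "(f has_field_derivative (1 / (1 + y) - 1 + y)) (at y within ?S)"
      unfolding f_def using pos by (auto intro!: derivative_eq_intros)
    moreover have "1 / (1 + y) - 1 + y = y\<^sup>2 / (1 + y)"
      using pos by (simp add: field_simps power2_eq_square)
    ultimately show "(f has_field_derivative y\<^sup>2 / (1 + y)) (at y within ?S)" by simp
    have "y\<^sup>2 / (1 + y) \<le> x\<^sup>2 / (1 / 2)"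
      using pos abs by (intro frac_le) (auto simp: abs_le_square_iff)
    then show "norm (y\<^sup>2 / (1 + y)) \<le> 2 * x\<^sup>2" using pos by simp
  qed auto
  then show ?thesis by (simp add: f_def power2_eq_square power3_eq_cube abs_mult)
qed

text \<open>The bound involves neither the number of points nor the weights. This is what turns
  pointwise estimates into estimates uniform over all designs.\<close>

lemma abs_weighted_sum_le:
  fixes w f :: "'a \<Rightarrow> real"
  assumes "\<And>i. i \<in> S \<Longrightarrow> 0 \<le> w i" and "sum w S = 1"
    and "\<And>i. i \<in> S \<Longrightarrow> \<bar>f i\<bar> \<le> B"
  shows "\<bar>\<Sum>i\<in>S. f i * w i\<bar> \<le> B"
proof -
  have "\<bar>\<Sum>i\<in>S. f i * w i\<bar> \<le> (\<Sum>i\<in>S. \<bar>f i\<bar> * w i)"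
    by (rule order_trans[OF sum_abs]) (simp add: abs_mult assms(1))
  also have "\<dots> \<le> (\<Sum>i\<in>S. B * w i)" by (intro sum_mono mult_right_mono assms)
  also have "\<dots> = B" using assms(2) by (simp flip: sum_distrib_left)
  finally show ?thesis .
qed

lemma abs_diff_squares_le:
  fixes a b :: real
  assumes "\<bar>a - b\<bar> \<le> \<rho>" and "\<bar>a\<bar> \<le> \<delta>" and "\<bar>b\<bar> \<le> \<delta>"
  shows "\<bar>a\<^sup>2 - b\<^sup>2\<bar> \<le> 2 * \<rho> * \<delta>"
proof -
  have "\<bar>a\<^sup>2 - b\<^sup>2\<bar> = \<bar>a - b\<bar> * \<bar>a + b\<bar>"
    by (simp add: power2_eq_square square_diff_square_factored abs_mult mult.commute)
  also have "\<dots> \<le> \<rho> * (2 * \<delta>)" using assms by (intro mult_mono) auto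
  finally show ?thesis by simp
qed

text \<open>Expanding both logarithms to second order cancels the mean of \<open>d\<close> and
  leaves half its variance; the variance of \<open>d\<close> is then exchanged for that of its
  approximation \<open>g\<close>. Two scales are kept apart: \<open>\<delta>\<close> bounds the
  deviations themselves, \<open>\<rho>\<close> the much smaller gap between them.\<close>

lemma ln_mean_minus_mean_ln:
  fixes w d g :: "'a \<Rightarrow> real"
  assumes w: "\<And>i. i \<in> S \<Longrightarrow> 0 \<le> w i" "sum w S = 1"
    and near: "\<And>i. i \<in> S \<Longrightarrow> \<bar>d i - g i\<bar> \<le> \<rho>"
    and d: "\<And>i. i \<in> S \<Longrightarrow> \<bar>d i\<bar> \<le> \<delta>"
    and g: "\<And>i. i \<in> S \<Longrightarrow> \<bar>g i\<bar> \<le> \<delta>"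
    and "\<delta> \<le> 1 / 2"
  shows "\<bar>(ln (\<Sum>i\<in>S. (1 + d i) * w i) - (\<Sum>i\<in>S. ln (1 + d i) * w i))
           - ((\<Sum>i\<in>S. (g i)\<^sup>2 * w i) - (\<Sum>i\<in>S. g i * w i)\<^sup>2) / 2\<bar> \<le> 4 * \<delta> ^ 3 + 2 * \<rho> * \<delta>"
proof -
  define E where "E f = (\<Sum>i\<in>S. f i * w i)" for f :: "'a \<Rightarrow> real"
  note E_le = abs_weighted_sum_le[where w = w and S = S, OF w, folded E_def]
  have E_diff: "E (\<lambda>i. f i - k i) = E f - E k" for f k
    unfolding E_def by (simp add: left_diff_distrib sum_subtractf)
  \<comment> \<open>The mean of \<open>d\<close> obeys the same bound as its values, so the scalar
    expansion applies to the logarithm of the mean as well.\<close>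
  have E_d: "\<bar>E d\<bar> \<le> \<delta>" and E_g: "\<bar>E g\<bar> \<le> \<delta>"
    using E_le d g by blast+
  have ln_le: "\<bar>ln (1 + x) - x + x\<^sup>2 / 2\<bar> \<le> 2 * \<delta> ^ 3" if "\<bar>x\<bar> \<le> \<delta>" for x
  proof -
    have "\<bar>x\<bar> ^ 3 \<le> \<delta> ^ 3" by (intro power_mono that) simp
    moreover have "\<bar>ln (1 + x) - x + x\<^sup>2 / 2\<bar> \<le> 2 * \<bar>x\<bar> ^ 3"
      using that assms(6) by (intro abs_ln_one_plus_second_order) linarith
    ultimately show ?thesis by linarith
  qed
  have mean_one: "E (\<lambda>i. 1 + d i) = 1 + E d"
    unfolding E_def by (simp add: distrib_right sum.distrib w)
  have "\<bar>E (\<lambda>i. ln (1 + d i) - d i + (d i)\<^sup>2 / 2)\<bar> \<le> 2 * \<delta> ^ 3"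
    by (intro E_le ln_le d)
  moreover have "E (\<lambda>i. ln (1 + d i) - d i + (d i)\<^sup>2 / 2)
      = E (\<lambda>i. ln (1 + d i)) - E d + E (\<lambda>i. (d i)\<^sup>2) / 2"
    unfolding E_def
    by (simp add: distrib_right left_diff_distrib sum.distrib sum_subtractf sum_divide_distrib)
  moreover have "\<bar>ln (1 + E d) - E d + (E d)\<^sup>2 / 2\<bar> \<le> 2 * \<delta> ^ 3"
    by (rule ln_le[OF E_d])
  moreover have "\<bar>E (\<lambda>i. (d i)\<^sup>2) - E (\<lambda>i. (g i)\<^sup>2)\<bar> \<le> 2 * \<rho> * \<delta>"
    unfolding E_diff[symmetric] by (intro E_le abs_diff_squares_le near d g)
  moreover have "\<bar>(E d)\<^sup>2 - (E g)\<^sup>2\<bar> \<le> 2 * \<rho> * \<delta>"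
  proof (rule abs_diff_squares_le[OF _ E_d E_g])
    show "\<bar>E d - E g\<bar> \<le> \<rho>" unfolding E_diff[symmetric] by (intro E_le near)
  qed
  \<comment> \<open>Error count: the two logarithmic remainders give \<open>2 * \<delta> ^ 3\<close>
    each; the second moment and the squared mean give \<open>2 * \<rho> * \<delta>\<close> each,
    halved by the factor 1/2 of the variance.\<close>
  ultimately have "\<bar>(ln (1 + E d) - E (\<lambda>i. ln (1 + d i)))
      - (E (\<lambda>i. (g i)\<^sup>2) - (E g)\<^sup>2) / 2\<bar> \<le> 4 * \<delta> ^ 3 + 2 * \<rho> * \<delta>"
    by (simp add: abs_le_iff) argo
  then show ?thesis unfolding mean_one[symmetric] by (simp add: E_def)
qed

section \<open>Taylor remainder in the parameter\<close>

text \<open>A linear map is determined by its values on the axis vectors, and these are the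
  coordinates of the gradient.\<close>

lemma has_derivative_gradient:
  assumes "f differentiable (at \<gamma>)"
  shows "(f has_derivative (\<lambda>v. gradient f \<gamma> \<bullet> v)) (at \<gamma>)"
proof -
  let ?D = "frechet_derivative f (at \<gamma>)"
  have lin: "linear ?D" by (rule linear_frechet_derivative[OF assms])
  have "?D v = gradient f \<gamma> \<bullet> v" for v
  proof -
    have "?D v = ?D (\<Sum>i\<in>UNIV. (v $ i) *\<^sub>R axis i 1)"
      by (simp add: basis_expansion flip: scalar_mult_eq_scaleR)
    also have "\<dots> = (\<Sum>i\<in>UNIV. v $ i * ?D (axis i 1))"
      by (simp add: linear_sum[OF lin] linear_scale[OF lin])
    also have "\<dots> = gradient f \<gamma> \<bullet> v"
      by (simp add: gradient_def inner_vec_def mult.commute)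
    finally show ?thesis .
  qed
  then have "?D = (\<lambda>v. gradient f \<gamma> \<bullet> v)" by (rule ext)
  then show ?thesis using assms frechet_derivative_works by metis
qed

text \<open>The mean value inequality is used twice. The Hessian bound makes the gradient vary by at
  most \<open>M * norm (y - \<gamma>0)\<close>, and this in turn bounds the derivative of
  \<open>f\<close> minus its linear part. The constant is \<open>M\<close> rather than
  \<open>M / 2\<close>, which does not affect the order.\<close>

lemma first_order_remainder:
  fixes f :: "real ^ 's \<Rightarrow> real"
  assumes f: "twice_continuously_differentiable_on f (ball \<gamma>0 r)"
    and M: "\<And>\<gamma>. \<gamma> \<in> ball \<gamma>0 r \<Longrightarrow> spectral_norm (hessian f \<gamma>) \<le> M"
    and \<gamma>: "\<gamma> \<in> ball \<gamma>0 r"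
  shows "\<bar>f \<gamma> - f \<gamma>0 - gradient f \<gamma>0 \<bullet> (\<gamma> - \<gamma>0)\<bar> \<le> M * (norm (\<gamma> - \<gamma>0))\<^sup>2"
proof -
  have centre: "\<gamma>0 \<in> ball \<gamma>0 r" using \<gamma> by (auto intro: le_less_trans[OF zero_le_dist])
  have "0 \<le> spectral_norm (hessian f \<gamma>0)"
    unfolding spectral_norm_def by (rule onorm_pos_le[OF matrix_vector_mul_bounded_linear])
  with M[OF centre] have "0 \<le> M" by linarith
  have lip: "norm (gradient f y - gradient f \<gamma>0) \<le> M * norm (y - \<gamma>0)"
    if "y \<in> ball \<gamma>0 r" for y
  proof (rule differentiable_bound[OF convex_ball _ _ that centre])
    fix z assume z: "z \<in> ball \<gamma>0 r"
    then have "gradient f differentiable (at z)"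
      using f by (simp add: twice_continuously_differentiable_on_def)
    then show "(gradient f has_derivative (\<lambda>v. hessian f z *v v)) (at z within ball \<gamma>0 r)"
      unfolding hessian_def jacobian_works by (rule has_derivative_at_withinI)
    show "onorm (\<lambda>v. hessian f z *v v) \<le> M" using M[OF z] by (simp add: spectral_norm_def)
  qed
  \<comment> \<open>Subtracting the linear part makes the gradient of \<open>k\<close> the
    difference controlled by \<open>lip\<close>. Working on the closed ball of radius
    \<open>?R\<close> instead of \<open>r\<close> gives the derivative bound \<open>M * ?R\<close>,
    hence a remainder quadratic in \<open>?R\<close>.\<close>
  define k where "k y = f y - gradient f \<gamma>0 \<bullet> y" for y
  let ?R = "norm (\<gamma> - \<gamma>0)"
  have sub: "cball \<gamma>0 ?R \<subseteq> ball \<gamma>0 r"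
    using \<gamma> by (auto simp: dist_norm norm_minus_commute)
  have "norm (k \<gamma> - k \<gamma>0) \<le> (M * ?R) * norm (\<gamma> - \<gamma>0)"
  proof (rule differentiable_bound[OF convex_cball[of \<gamma>0 ?R]])
    fix y assume y: "y \<in> cball \<gamma>0 ?R"
    with sub have yb: "y \<in> ball \<gamma>0 r" by blast
    then have "f differentiable (at y)"
      using f by (simp add: twice_continuously_differentiable_on_def)
    from has_derivative_at_withinI[OF has_derivative_gradient[OF this]]
    show "(k has_derivative (\<lambda>v. (gradient f y - gradient f \<gamma>0) \<bullet> v))
        (at y within cball \<gamma>0 ?R)"
      unfolding k_def by (auto intro!: derivative_eq_intros simp: inner_diff_left)
    have "norm (gradient f y - gradient f \<gamma>0) \<le> M * norm (y - \<gamma>0)" by (rule lip[OF yb])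
    also have "\<dots> \<le> M * ?R"
      using y \<open>0 \<le> M\<close> by (intro mult_left_mono) (auto simp: dist_norm norm_minus_commute)
    finally have le: "norm (gradient f y - gradient f \<gamma>0) \<le> M * ?R" .
    show "onorm (\<lambda>v. (gradient f y - gradient f \<gamma>0) \<bullet> v) \<le> M * ?R"
    proof (rule onorm_le)
      fix v
      show "norm ((gradient f y - gradient f \<gamma>0) \<bullet> v) \<le> M * ?R * norm v"
        unfolding real_norm_def
        by (rule order_trans[OF Cauchy_Schwarz_ineq2 mult_right_mono[OF le norm_ge_zero]])
    qed
  qed (auto simp: dist_norm norm_minus_commute)
  then show ?thesis by (simp add: k_def inner_diff_right power2_eq_square algebra_simps)
qed

section \<open>The noncentrality parameter as a variance\<close>

lemma outer_square_mult: "outer_square u *v l = (u \<bullet> l) *\<^sub>R u"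
  by (simp add: vec_eq_iff outer_square_def matrix_matrix_mult_def matrix_vector_mult_def
      columnvector_def rowvector_def inner_vec_def sum_distrib_left mult_ac)

lemma sum_matrix_vector_mult:
  fixes A :: "'a \<Rightarrow> real ^ 'n ^ 'm"
  shows "(\<Sum>x\<in>S. A x) *v v = (\<Sum>x\<in>S. A x *v v)"
  by (induction S rule: infinite_finite_induct) (auto simp: matrix_vector_mult_add_rdistrib)

text \<open>The quadratic form of an outer square \<open>u u^T\<close> at \<open>l\<close> is
  \<open>(u \<bullet> l)\<^sup>2\<close>. The matrix is thus the covariance of the gradients, and
  the form is the variance of the directional derivatives along \<open>l\<close>.\<close>

lemma noncentrality_eq_variance:
  "noncentrality h \<xi> l \<gamma>0 =
     ((\<Sum>x\<in>set_pmf \<xi>. (gradient (h x) \<gamma>0 \<bullet> l)\<^sup>2 * pmf \<xi> x)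
       - (\<Sum>x\<in>set_pmf \<xi>. (gradient (h x) \<gamma>0 \<bullet> l) * pmf \<xi> x)\<^sup>2) / 2"
  by (simp add: noncentrality_def matrix_vector_mult_diff_rdistrib sum_matrix_vector_mult
      outer_square_mult inner_diff_right inner_sum_right inner_sum_left inner_commute[of l]
      power2_eq_square mult.commute mult.left_commute flip: scaleR_matrix_vector_assoc)

section \<open>Closed form of the KL-criterion\<close>

text \<open>Splitting \<open>ln (v1 * h / v)\<close> into \<open>ln (v1 / v)\<close> and
  \<open>ln h\<close> separates a part governed by the variance \<open>v\<close> alone, a part free
  of both minimisation variables, and a nonnegative mean discrepancy, the only place where
  \<open>\<beta>\<close> enters.\<close>

lemma KL_objective_eq:
  assumes "finite (set_pmf \<xi>)" and pos: "\<And>x. 0 < h x \<gamma>" and "0 < v1" and "0 < v"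
  shows "KL_objective \<mu> h \<beta>1 v1 \<xi> \<gamma> \<beta> v =
    (v1 * (\<Sum>x\<in>set_pmf \<xi>. h x \<gamma> * pmf \<xi> x) / v - ln (v1 / v))
      - (\<Sum>x\<in>set_pmf \<xi>. ln (h x \<gamma>) * pmf \<xi> x)
      + (\<Sum>x\<in>set_pmf \<xi>. (\<mu> x \<beta>1 - \<mu> x \<beta>)\<^sup>2 * pmf \<xi> x) / v"
proof -
  have one: "sum (pmf \<xi>) (set_pmf \<xi>) = 1" using assms(1) by (simp add: sum_pmf_eq_1)
  have "KL_objective \<mu> h \<beta>1 v1 \<xi> \<gamma> \<beta> v =
    (\<Sum>x\<in>set_pmf \<xi>. v1 * (h x \<gamma> * pmf \<xi> x) / v - ln (v1 / v) * pmf \<xi> x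
      - ln (h x \<gamma>) * pmf \<xi> x + (\<mu> x \<beta>1 - \<mu> x \<beta>)\<^sup>2 * pmf \<xi> x / v)"
    unfolding KL_objective_def
  proof (rule sum.cong[OF refl])
    fix x
    have "ln (v1 * h x \<gamma> / v) = ln (v1 / v) + ln (h x \<gamma>)"
      using pos[of x] assms(3,4) ln_mult[of "v1 / v" "h x \<gamma>"] by simp
    then show "((v1 * h x \<gamma> + (\<mu> x \<beta>1 - \<mu> x \<beta>)\<^sup>2) / v - ln (v1 * h x \<gamma> / v)) * pmf \<xi> x
      = v1 * (h x \<gamma> * pmf \<xi> x) / v - ln (v1 / v) * pmf \<xi> x
      - ln (h x \<gamma>) * pmf \<xi> x + (\<mu> x \<beta>1 - \<mu> x \<beta>)\<^sup>2 * pmf \<xi> x / v"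
      by (simp add: algebra_simps add_divide_distrib)
  qed
  also have "\<dots> = v1 * (\<Sum>x\<in>set_pmf \<xi>. h x \<gamma> * pmf \<xi> x) / v - ln (v1 / v) * sum (pmf \<xi>) (set_pmf \<xi>)
      - (\<Sum>x\<in>set_pmf \<xi>. ln (h x \<gamma>) * pmf \<xi> x)
      + (\<Sum>x\<in>set_pmf \<xi>. (\<mu> x \<beta>1 - \<mu> x \<beta>)\<^sup>2 * pmf \<xi> x) / v"
    by (simp only: sum.distrib sum_subtractf sum_distrib_left sum_divide_distrib)
  finally show ?thesis by (simp add: one)
qed

text \<open>At \<open>\<beta>1\<close> the discrepancy vanishes, and at \<open>v = v1 * A\<close>,
  with \<open>A\<close> the mean of \<open>h\<close>, the variance part equals
  \<open>1 + ln A\<close>. No other choice gives a smaller value.\<close>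

lemma KL_criterion_eq:
  assumes fin: "finite (set_pmf \<xi>)" and pos: "\<And>x. 0 < h x \<gamma>" and "0 < v1"
  shows "KL_criterion \<mu> h \<beta>1 v1 \<xi> \<gamma> =
    1 + (ln (\<Sum>x\<in>set_pmf \<xi>. h x \<gamma> * pmf \<xi> x) - (\<Sum>x\<in>set_pmf \<xi>. ln (h x \<gamma>) * pmf \<xi> x))"
proof -
  define A where "A = (\<Sum>x\<in>set_pmf \<xi>. h x \<gamma> * pmf \<xi> x)"
  note eq = KL_objective_eq[where h = h and \<gamma> = \<gamma>, OF fin pos \<open>0 < v1\<close>, folded A_def]
  have "0 < A" unfolding A_def
    by (intro sum_pos mult_pos_pos pos fin set_pmf_not_empty) (simp add: pmf_positive)
  show ?thesis unfolding KL_criterion_def A_def[symmetric]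
  proof (rule Least_equality)
    have "0 < v1 * A" using \<open>0 < A\<close> \<open>0 < v1\<close> by simp
    then show "\<exists>\<beta> v. v > 0 \<and> 1 + (ln A - (\<Sum>x\<in>set_pmf \<xi>. ln (h x \<gamma>) * pmf \<xi> x))
        = KL_objective \<mu> h \<beta>1 v1 \<xi> \<gamma> \<beta> v"
      using \<open>0 < A\<close> \<open>0 < v1\<close>
      by (intro exI[of _ \<beta>1] exI[of _ "v1 * A"]) (simp add: eq ln_div)
  next
    fix c assume "\<exists>\<beta> v. v > 0 \<and> c = KL_objective \<mu> h \<beta>1 v1 \<xi> \<gamma> \<beta> v"
    then obtain \<beta> v where v: "v > 0" and c: "c = KL_objective \<mu> h \<beta>1 v1 \<xi> \<gamma> \<beta> v" by blast
    \<comment> \<open>With \<open>y = v1 * A / v\<close> the variance part is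
      \<open>y - ln y + ln A\<close>, so this inequality bounds it below by
      \<open>1 + ln A\<close>.\<close>
    have "ln (v1 * A / v) \<le> v1 * A / v - 1"
      using \<open>0 < A\<close> \<open>0 < v1\<close> v by (intro ln_le_minus_one) simp
    moreover have "ln (v1 * A / v) = ln (v1 / v) + ln A"
      using \<open>0 < A\<close> \<open>0 < v1\<close> v ln_mult[of "v1 / v" A] by simp
    moreover have "0 \<le> (\<Sum>x\<in>set_pmf \<xi>. (\<mu> x \<beta>1 - \<mu> x \<beta>)\<^sup>2 * pmf \<xi> x) / v"
      using v by (intro divide_nonneg_pos sum_nonneg) auto
    ultimately show "1 + (ln A - (\<Sum>x\<in>set_pmf \<xi>. ln (h x \<gamma>) * pmf \<xi> x)) \<le> c"
      unfolding c eq[OF v] by linarith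
  qed
qed

section \<open>Boundedness and rate of the approximation error\<close>

lemma approximation_error_eq:
  assumes "\<xi> \<in> designs X" and "\<And>x \<gamma>. 0 < h x \<gamma>" and "0 < v1"
  shows "approximation_error \<mu> h \<beta>1 v1 \<gamma>0 l n \<xi> =
    \<bar>real n * (ln (\<Sum>x\<in>set_pmf \<xi>. h x (\<gamma>0 + (1 / sqrt (real n)) *\<^sub>R l) * pmf \<xi> x)
        - (\<Sum>x\<in>set_pmf \<xi>. ln (h x (\<gamma>0 + (1 / sqrt (real n)) *\<^sub>R l)) * pmf \<xi> x))
      - ((\<Sum>x\<in>set_pmf \<xi>. (gradient (h x) \<gamma>0 \<bullet> l)\<^sup>2 * pmf \<xi> x)
       - (\<Sum>x\<in>set_pmf \<xi>. (gradient (h x) \<gamma>0 \<bullet> l) * pmf \<xi> x)\<^sup>2) / 2\<bar>"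
  using assms unfolding approximation_error_def noncentrality_eq_variance
  by (subst KL_criterion_eq) (auto simp: designs_def)

text \<open>A real supremum is informative only over a set bounded above. For small \<open>n\<close>
  the shifted parameter may leave the ball where the Taylor estimate holds, so the bound comes from
  compactness: a continuous positive function on \<open>X\<close> lies between two positive
  constants.\<close>

lemma bdd_above_approximation_error:
  fixes X :: "(real ^ 'p) set" and h :: "real ^ 'p \<Rightarrow> real ^ 's \<Rightarrow> real"
  assumes X: "compact X" "X \<noteq> {}"
    and cont: "continuous_on UNIV (\<lambda>(x, \<gamma>). h x \<gamma>)"
    and pos: "\<And>x \<gamma>. 0 < h x \<gamma>" and "0 < v1"
    and M1: "\<And>x. x \<in> X \<Longrightarrow> norm (gradient (h x) \<gamma>0) \<le> M1"
  shows "bdd_above (approximation_error \<mu> h \<beta>1 v1 \<gamma>0 l n ` designs X)"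
proof -
  define \<gamma> where "\<gamma> = \<gamma>0 + (1 / sqrt (real n)) *\<^sub>R l"
  have "continuous_on X ((\<lambda>(x, \<gamma>). h x \<gamma>) \<circ> (\<lambda>x. (x, \<gamma>)))"
    by (intro continuous_on_compose continuous_intros continuous_on_subset[OF cont]) auto
  then have ch: "continuous_on X (\<lambda>x. h x \<gamma>)" by (simp add: o_def)
  obtain xa where xa: "\<And>x. x \<in> X \<Longrightarrow> h xa \<gamma> \<le> h x \<gamma>"
    using continuous_attains_inf[OF X ch] by blast
  obtain xb where xb: "\<And>x. x \<in> X \<Longrightarrow> h x \<gamma> \<le> h xb \<gamma>"
    using continuous_attains_sup[OF X ch] by blast
  \<comment> \<open>Each value of \<open>h\<close> on the support, and hence its mean over any
    design, lies between \<open>a\<close> and \<open>b\<close>. The constant \<open>B\<close> bounds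
    the logarithm on that interval whatever its sign.\<close>
  define a b where "a = h xa \<gamma>" and "b = h xb \<gamma>"
  define B where "B = \<bar>ln a\<bar> + \<bar>ln b\<bar>"
  define G where "G = M1 * norm l"
  have "0 < a" unfolding a_def by (rule pos)
  have ln_B: "\<bar>ln y\<bar> \<le> B" if "a \<le> y" "y \<le> b" for y
  proof -
    have "ln a \<le> ln y" "ln y \<le> ln b" using that \<open>0 < a\<close> by auto
    then show ?thesis unfolding B_def by linarith
  qed
  have half_diff_le: "\<bar>(p - q) / 2\<bar> \<le> c" if "\<bar>p\<bar> \<le> c" "q \<le> c" "0 \<le> q" for p q c :: real
    using that by (simp add: abs_le_iff)
  have "approximation_error \<mu> h \<beta>1 v1 \<gamma>0 l n \<xi> \<le> real n * (2 * B) + G\<^sup>2" if \<xi>: "\<xi> \<in> designs X" for \<xi>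
  proof -
    define E where "E f = (\<Sum>x\<in>set_pmf \<xi>. f x * pmf \<xi> x)" for f :: "real ^ 'p \<Rightarrow> real"
    define g where "g x = gradient (h x) \<gamma>0 \<bullet> l" for x
    have fin: "finite (set_pmf \<xi>)" and in_X: "\<And>x. x \<in> set_pmf \<xi> \<Longrightarrow> x \<in> X"
      using \<xi> by (auto simp: designs_def)
    have one: "sum (pmf \<xi>) (set_pmf \<xi>) = 1" using fin by (simp add: sum_pmf_eq_1)
    note E_le = abs_weighted_sum_le[where w = "pmf \<xi>" and S = "set_pmf \<xi>", OF pmf_nonneg one, folded E_def]
    have "a * sum (pmf \<xi>) (set_pmf \<xi>) \<le> E (\<lambda>x. h x \<gamma>)"
      unfolding E_def sum_distrib_left a_def by (intro sum_mono mult_right_mono xa in_X) auto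
    moreover have "E (\<lambda>x. h x \<gamma>) \<le> b * sum (pmf \<xi>) (set_pmf \<xi>)"
      unfolding E_def sum_distrib_left b_def by (intro sum_mono mult_right_mono xb in_X) auto
    ultimately have "\<bar>ln (E (\<lambda>x. h x \<gamma>))\<bar> \<le> B" by (intro ln_B) (simp_all add: one)
    moreover have "\<bar>E (\<lambda>x. ln (h x \<gamma>))\<bar> \<le> B"
      by (intro E_le ln_B) (simp_all add: a_def b_def xa xb in_X)
    ultimately have "\<bar>ln (E (\<lambda>x. h x \<gamma>)) - E (\<lambda>x. ln (h x \<gamma>))\<bar> \<le> 2 * B" by linarith
    then have 1: "\<bar>real n * (ln (E (\<lambda>x. h x \<gamma>)) - E (\<lambda>x. ln (h x \<gamma>)))\<bar> \<le> real n * (2 * B)"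
      by (simp add: abs_mult mult_left_mono)
    have g: "\<bar>g x\<bar> \<le> G" if "x \<in> set_pmf \<xi>" for x
      unfolding g_def G_def using Cauchy_Schwarz_ineq2[of "gradient (h x) \<gamma>0" l]
        mult_right_mono[OF M1[OF in_X[OF that]] norm_ge_zero[of l]] by linarith
    have "\<bar>E (\<lambda>x. (g x)\<^sup>2)\<bar> \<le> G\<^sup>2"
    proof (rule E_le)
      fix x assume "x \<in> set_pmf \<xi>"
      from power_mono[OF g[OF this], of 2] show "\<bar>(g x)\<^sup>2\<bar> \<le> G\<^sup>2" by simp
    qed
    moreover have "(E g)\<^sup>2 \<le> G\<^sup>2"
      using power_mono[of "\<bar>E g\<bar>" G 2] E_le[OF g] by simp
    ultimately have "\<bar>(E (\<lambda>x. (g x)\<^sup>2) - (E g)\<^sup>2) / 2\<bar> \<le> G\<^sup>2"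
      by (intro half_diff_le) auto
    with 1 show ?thesis
      unfolding approximation_error_eq[where h = h, OF \<xi> pos \<open>0 < v1\<close>] \<gamma>_def[symmetric]
        g_def[symmetric] E_def[symmetric] by linarith
  qed
  then show ?thesis by (rule bdd_aboveI2)
qed

text \<open>The averaged expansion is applied with \<open>t = 1 / sqrt n\<close>, deviations of size
  \<open>K * t\<close> and a Taylor gap of size \<open>t\<^sup>2\<close>. Its error is of order
  \<open>t ^ 3\<close>, and multiplication by \<open>n\<close> leaves order \<open>t\<close>. The
  hypothesis \<open>nr\<close> keeps the shifted parameter in the ball; \<open>nK\<close> keeps the
  deviations within 1/2. The constant depends only on \<open>M1\<close>, \<open>M2\<close> and
  \<open>L\<close>.\<close>

lemma approximation_error_le:
  fixes X :: "(real ^ 'p) set" and h :: "real ^ 'p \<Rightarrow> real ^ 's \<Rightarrow> real"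
  assumes pos: "\<And>x \<gamma>. 0 < h x \<gamma>" and "0 < v1"
    and h1: "\<And>x. x \<in> X \<Longrightarrow> h x \<gamma>0 = 1"
    and smooth: "\<And>x. x \<in> X \<Longrightarrow> twice_continuously_differentiable_on (h x) (ball \<gamma>0 r)"
    and M1: "\<And>x. x \<in> X \<Longrightarrow> norm (gradient (h x) \<gamma>0) \<le> M1"
    and M2: "\<And>x \<gamma>. x \<in> X \<Longrightarrow> \<gamma> \<in> ball \<gamma>0 r \<Longrightarrow> spectral_norm (hessian (h x) \<gamma>) \<le> M2"
    and l: "norm l \<le> L" and "0 \<le> M1" "0 \<le> M2" and "1 \<le> n"
    and nr: "L / sqrt (real n) < r"
    and nK: "(M1 * L + M2 * L\<^sup>2) / sqrt (real n) \<le> 1 / 2"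
    and \<xi>: "\<xi> \<in> designs X"
  shows "approximation_error \<mu> h \<beta>1 v1 \<gamma>0 l n \<xi>
    \<le> (4 * (M1 * L + M2 * L\<^sup>2) ^ 3 + 2 * (M2 * L\<^sup>2) * (M1 * L + M2 * L\<^sup>2)) * real n powr (- 1 / 2)"
proof -
  define t where "t = 1 / sqrt (real n)"
  define K where "K = M1 * L + M2 * L\<^sup>2"
  define \<gamma> where "\<gamma> = \<gamma>0 + t *\<^sub>R l"
  define g where "g x = gradient (h x) \<gamma>0 \<bullet> l" for x
  define d where "d x = h x \<gamma> - 1" for x
  define \<rho> where "\<rho> = M2 * L\<^sup>2 * t\<^sup>2"
  have t: "0 < t" "t \<le> 1" and nt: "real n * t\<^sup>2 = 1"
    using \<open>1 \<le> n\<close> by (auto simp: t_def power_divide)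
  have "0 \<le> L" using l norm_ge_zero[of l] by linarith
  have norm_d: "norm (\<gamma> - \<gamma>0) \<le> t * L" using t l by (simp add: \<gamma>_def)
  have "t * L < r" using nr by (simp add: t_def)
  with norm_d have \<gamma>_in: "\<gamma> \<in> ball \<gamma>0 r" by (simp add: dist_norm norm_minus_commute)
  \<comment> \<open>Since \<open>t \<le> 1\<close>, the quadratic gap is also at most linear in
    \<open>t\<close>, so \<open>K * t\<close> bounds both \<open>d\<close> and its linear
    approximation. In the product \<open>\<rho> * (K * t)\<close> the sharper quadratic form of
    \<open>\<rho>\<close> is retained.\<close>
  have \<rho>_le: "\<rho> \<le> M2 * L\<^sup>2 * t" unfolding \<rho>_def
    using t \<open>0 \<le> M2\<close> by (intro mult_left_mono) (auto simp: power2_eq_square mult_left_le)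
  have fin: "finite (set_pmf \<xi>)" and in_X: "\<And>x. x \<in> set_pmf \<xi> \<Longrightarrow> x \<in> X"
    using \<xi> by (auto simp: designs_def)
  have one: "sum (pmf \<xi>) (set_pmf \<xi>) = 1" using fin by (simp add: sum_pmf_eq_1)
  have near: "\<bar>d x - t * g x\<bar> \<le> \<rho>" if "x \<in> set_pmf \<xi>" for x
  proof -
    have x: "x \<in> X" by (rule in_X[OF that])
    have "\<bar>h x \<gamma> - h x \<gamma>0 - gradient (h x) \<gamma>0 \<bullet> (\<gamma> - \<gamma>0)\<bar> \<le> M2 * (norm (\<gamma> - \<gamma>0))\<^sup>2"
      by (rule first_order_remainder[OF smooth[OF x] M2[OF x] \<gamma>_in])
    also have "\<dots> \<le> M2 * (t * L)\<^sup>2"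
      by (intro mult_left_mono power_mono norm_d \<open>0 \<le> M2\<close>) simp
    finally show ?thesis by (simp add: \<rho>_def d_def g_def h1[OF x] \<gamma>_def power_mult_distrib mult_ac)
  qed
  have tg: "\<bar>t * g x\<bar> \<le> M1 * L * t" if "x \<in> set_pmf \<xi>" for x
  proof -
    have "\<bar>g x\<bar> \<le> norm (gradient (h x) \<gamma>0) * norm l"
      unfolding g_def by (rule Cauchy_Schwarz_ineq2)
    also have "\<dots> \<le> M1 * L" using M1[OF in_X[OF that]] l \<open>0 \<le> M1\<close> by (intro mult_mono) auto
    finally show ?thesis using t by (simp add: abs_mult mult.commute)
  qed
  have K_split: "K * t = M1 * L * t + M2 * L\<^sup>2 * t" by (simp add: K_def distrib_right)
  have "0 \<le> M2 * L\<^sup>2 * t" using \<open>0 \<le> M2\<close> t by simp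
  have "\<bar>(ln (\<Sum>x\<in>set_pmf \<xi>. (1 + d x) * pmf \<xi> x) - (\<Sum>x\<in>set_pmf \<xi>. ln (1 + d x) * pmf \<xi> x))
      - ((\<Sum>x\<in>set_pmf \<xi>. (t * g x)\<^sup>2 * pmf \<xi> x) - (\<Sum>x\<in>set_pmf \<xi>. t * g x * pmf \<xi> x)\<^sup>2) / 2\<bar>
    \<le> 4 * (K * t) ^ 3 + 2 * \<rho> * (K * t)"
  proof (rule ln_mean_minus_mean_ln)
    fix x assume x: "x \<in> set_pmf \<xi>"
    show "\<bar>d x - t * g x\<bar> \<le> \<rho>" by (rule near[OF x])
    show "\<bar>d x\<bar> \<le> K * t" and "\<bar>t * g x\<bar> \<le> K * t"
      using near[OF x] tg[OF x] \<rho>_le K_split \<open>0 \<le> M2 * L\<^sup>2 * t\<close> by linarith+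
  next
    show "K * t \<le> 1 / 2" using nK by (simp add: K_def t_def)
  qed (simp_all add: one)
  moreover have "4 * (K * t) ^ 3 + 2 * \<rho> * (K * t) = t ^ 3 * (4 * K ^ 3 + 2 * (M2 * L\<^sup>2) * K)"
    unfolding \<rho>_def by (simp add: algebra_simps power2_eq_square power3_eq_cube)
  moreover have "(\<Sum>x\<in>set_pmf \<xi>. (t * g x)\<^sup>2 * pmf \<xi> x) = t\<^sup>2 * (\<Sum>x\<in>set_pmf \<xi>. (g x)\<^sup>2 * pmf \<xi> x)"
    "(\<Sum>x\<in>set_pmf \<xi>. t * g x * pmf \<xi> x)\<^sup>2 = t\<^sup>2 * (\<Sum>x\<in>set_pmf \<xi>. g x * pmf \<xi> x)\<^sup>2"
    by (simp_all add: power_mult_distrib mult.assoc flip: sum_distrib_left)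
  ultimately have bound: "\<bar>(ln (\<Sum>x\<in>set_pmf \<xi>. h x \<gamma> * pmf \<xi> x) - (\<Sum>x\<in>set_pmf \<xi>. ln (h x \<gamma>) * pmf \<xi> x))
      - t\<^sup>2 * (((\<Sum>x\<in>set_pmf \<xi>. (g x)\<^sup>2 * pmf \<xi> x) - (\<Sum>x\<in>set_pmf \<xi>. g x * pmf \<xi> x)\<^sup>2) / 2)\<bar>
    \<le> t ^ 3 * (4 * K ^ 3 + 2 * (M2 * L\<^sup>2) * K)" (is "\<bar>?Q - t\<^sup>2 * ?V\<bar> \<le> _")
    by (simp add: d_def right_diff_distrib)
  \<comment> \<open>Because \<open>n * t\<^sup>2 = 1\<close>, scaling by \<open>n\<close> restores
    the unscaled variance and lowers the cubic error to first order in \<open>t\<close>.\<close>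
  have "real n * ?Q - ?V = real n * (?Q - t\<^sup>2 * ?V)"
    using nt by (simp add: right_diff_distrib flip: mult.assoc)
  then have "\<bar>real n * ?Q - ?V\<bar> = real n * \<bar>?Q - t\<^sup>2 * ?V\<bar>" by (simp add: abs_mult)
  also have "\<dots> \<le> real n * (t ^ 3 * (4 * K ^ 3 + 2 * (M2 * L\<^sup>2) * K))"
    by (intro mult_left_mono bound) simp
  also have "\<dots> = (real n * t\<^sup>2) * t * (4 * K ^ 3 + 2 * (M2 * L\<^sup>2) * K)"
    by (simp add: power2_eq_square power3_eq_cube)
  also have "\<dots> = (4 * K ^ 3 + 2 * (M2 * L\<^sup>2) * K) * t" unfolding nt by simp
  also have "t = real n powr (- 1 / 2)"
    using \<open>1 \<le> n\<close> by (simp add: t_def powr_minus_divide powr_half_sqrt)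
  finally show ?thesis
    unfolding approximation_error_eq[where h = h, OF \<xi> pos \<open>0 < v1\<close>] t_def[symmetric]
      \<gamma>_def[symmetric] g_def[symmetric] K_def[symmetric] .
qed

section \<open>Uniform asymptotics over designs and directions\<close>

text \<open>The boundedness clause ensures that each \<open>SUP\<close> is a genuine supremum. The
  last conjunct adds uniformity over \<open>\<Lambda>\<close>: both the constant and the threshold
  for \<open>n\<close> are chosen before \<open>l\<close>.\<close>

theorem theorem7:
  fixes X :: "(real ^ 'p) set"
    and \<mu> :: "real ^ 'p \<Rightarrow> real ^ 'm \<Rightarrow> real"
    and h :: "real ^ 'p \<Rightarrow> real ^ 's \<Rightarrow> real"
    and \<beta>1 :: "real ^ 'm" and v1 :: real and \<gamma>0 :: "real ^ 's"
    and r M1 M2 L :: real and \<Lambda> :: "(real ^ 's) set"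
  assumes "compact X" and "X \<noteq> {}"
    and "continuous_on UNIV (\<lambda>(x, \<gamma>). h x \<gamma>)"
    and "\<And>x \<gamma>. h x \<gamma> > 0"
    and "\<And>x. x \<in> X \<Longrightarrow> h x \<gamma>0 = 1"
    and "v1 > 0"
    and "r > 0"
    and "\<And>x. x \<in> X \<Longrightarrow> twice_continuously_differentiable_on (h x) (ball \<gamma>0 r)"
    and "\<And>x. x \<in> X \<Longrightarrow> norm (gradient (h x) \<gamma>0) \<le> M1"
    and "\<And>x \<gamma>. x \<in> X \<Longrightarrow> \<gamma> \<in> ball \<gamma>0 r \<Longrightarrow> spectral_norm (hessian (h x) \<gamma>) \<le> M2"
    and "\<And>l. l \<in> \<Lambda> \<Longrightarrow> norm l \<le> L"
  shows "(\<forall>l\<in>\<Lambda>.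
            (\<forall>n\<ge>1. bdd_above (approximation_error \<mu> h \<beta>1 v1 \<gamma>0 l n ` designs X)) \<and>
            (\<lambda>n. SUP \<xi>\<in>designs X. approximation_error \<mu> h \<beta>1 v1 \<gamma>0 l n \<xi>)
              \<in> O(\<lambda>n. real n powr (- 1 / 2)))
       \<and> (\<exists>C. \<forall>\<^sub>F n in sequentially. \<forall>l\<in>\<Lambda>.
            (SUP \<xi>\<in>designs X. approximation_error \<mu> h \<beta>1 v1 \<gamma>0 l n \<xi>)
              \<le> C * real n powr (- 1 / 2))"
proof -
  let ?err = "approximation_error \<mu> h \<beta>1 v1 \<gamma>0"
  define K where "K = M1 * L + M2 * L\<^sup>2"
  define C where "C = 4 * K ^ 3 + 2 * (M2 * L\<^sup>2) * K"
  \<comment> \<open>A point of \<open>X\<close> yields the signs of \<open>M1\<close> and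
    \<open>M2\<close> and, as a one-point design, the nonemptiness required by the supremum
    rules.\<close>
  obtain x0 where x0: "x0 \<in> X" using assms(2) by blast
  have "0 \<le> M1" using assms(9)[OF x0] norm_ge_zero order_trans by blast
  have "0 \<le> spectral_norm (hessian (h x0) \<gamma>0)"
    unfolding spectral_norm_def by (rule onorm_pos_le[OF matrix_vector_mul_bounded_linear])
  then have "0 \<le> M2" using assms(10)[OF x0, of \<gamma>0] \<open>r > 0\<close> by simp
  have "return_pmf x0 \<in> designs X" using x0 by (simp add: designs_def)
  then have ne: "designs X \<noteq> {}" by blast
  have bdd: "bdd_above (?err l n ` designs X)" for l n
    by (rule bdd_above_approximation_error[OF assms(1-4,6,9)])
  have nonneg: "0 \<le> (SUP \<xi>\<in>designs X. ?err l n \<xi>)" for l n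
    by (rule cSUP_upper2[OF bdd \<open>return_pmf x0 \<in> designs X\<close>]) (simp add: approximation_error_def)
  have lim: "((\<lambda>n. c / sqrt (real n)) \<longlongrightarrow> 0) sequentially" for c
    by (intro real_tendsto_divide_at_top[OF tendsto_const]
        filterlim_compose[OF sqrt_at_top filterlim_real_sequentially])
  have "\<forall>\<^sub>F n in sequentially. L / sqrt (real n) < r"
    using order_tendstoD(2)[OF lim] \<open>r > 0\<close> by blast
  moreover have "\<forall>\<^sub>F n in sequentially. K / sqrt (real n) < 1 / 2"
    using order_tendstoD(2)[OF lim, of "1 / 2"] by simp
  moreover have "\<forall>\<^sub>F n in sequentially. 1 \<le> n" by (rule eventually_ge_at_top)
  \<comment> \<open>The three conditions on \<open>n\<close> involve only \<open>r\<close>,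
    \<open>K\<close> and \<open>L\<close>, so one threshold serves every \<open>l\<close> in
    \<open>\<Lambda>\<close>.\<close>
  ultimately have main: "\<forall>\<^sub>F n in sequentially. \<forall>l\<in>\<Lambda>.
      (SUP \<xi>\<in>designs X. ?err l n \<xi>) \<le> C * real n powr (- 1 / 2)"
  proof eventually_elim
    case (elim n)
    show ?case
    proof
      fix l assume l: "l \<in> \<Lambda>"
      show "(SUP \<xi>\<in>designs X. ?err l n \<xi>) \<le> C * real n powr (- 1 / 2)"
      proof (rule cSUP_least[OF ne])
        fix \<xi> assume "\<xi> \<in> designs X"
        then show "?err l n \<xi> \<le> C * real n powr (- 1 / 2)"
          unfolding C_def K_def
          using elim \<open>0 \<le> M1\<close> \<open>0 \<le> M2\<close>
          by (intro approximation_error_le[OF assms(4,6,5,8,9,10,11)] l) (auto simp: K_def)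
      qed
    qed
  qed
  \<comment> \<open>The O-bound concerns the norm of the supremum; as the supremum is nonnegative,
    the one-sided bound \<open>main\<close> suffices.\<close>
  have "(\<lambda>n. SUP \<xi>\<in>designs X. ?err l n \<xi>) \<in> O(\<lambda>n. real n powr (- 1 / 2))" if "l \<in> \<Lambda>" for l
  proof (rule bigoI[where c = C])
    from main show "\<forall>\<^sub>F n in sequentially.
        norm (SUP \<xi>\<in>designs X. ?err l n \<xi>) \<le> C * norm (real n powr (- 1 / 2))"
      by eventually_elim (use that nonneg in simp)
  qed
  with bdd main show ?thesis by (intro conjI ballI allI impI exI[of _ C])
qed

end
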